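(* Let $\Gamma=(G,\sigma)$ be a signed graph with $G=(V,E)$, $n=|V|$, let $p\ge 1$, and let $\lambda_1\le\lambda_2\le\dots\le\lambda_n$ be the variational eigenvalues of $\Delta_p^\sigma$. Let $f$ be an eigenfunction of $\Delta_p^\sigma$ corresponding to an eigenvalue $\lambda$. If $k\in\{1,\dots,n\}$ and $\lambda>\lambda_k$, then $\overline{\mathfrak W}(f)\le\overline{\mathfrak S}(f)\le n-k$.
   Context: Setting. $G=(V,E)$ is a finite simple undirected graph, $n=|V|$, with edge measure $w:E\to(0,\infty)$, vertex weight $\mu:V\to(0,\infty)$, potential $\kappa:V\to\mathbb R$ and signature $\sigma:E\to\{-1,1\}$; $\Gamma=(G,\sigma)$ is a signed graph. Values are written $w_{xy},\sigma_{xy},\mu_x,\kappa_x$, and $x\sim y$ means $\{x,y\}\in E$. Put $\Phi_p(t)=|t|^{p-2}t$ for $t\neq0$ and $\Phi_p(0)=0$. Eigenpairs. For $p>1$, $\Delta_p^\sigma f(x)=\sum_{y\sim x}w_{xy}\Phi_p(f(x)-\sigma_{xy}f(y))+\kappa_x\Phi_p(f(x))$, and a nonzero $f:V\to\mathbb R$ is an eigenfunction with eigenvalue $\lambda\in\mathbb R$ if $\Delta_p^\sigma f(x)=\lambda\mu_x\Phi_p(f(x))$ for all $x\in V$. For $p=1$, let $\mathrm{Sgn}(t)=\{1\}$ if $t>0$, $[-1,1]$ if $t=0$, $\{-1\}$ if $t<0$; a nonzero $f:V\to\mathbb R$ is an eigenfunction of $\Delta_1^\sigma$ with eigenvalue $\lambda$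 if there are numbers $z_{xy}\in\mathrm{Sgn}(f(x)-\sigma_{xy}f(y))$ (for all ordered pairs $x\sim y$) with $z_{xy}=-\sigma_{xy}z_{yx}$, and $z_x,z_x'\in\mathrm{Sgn}(f(x))$, such that $\sum_{y\sim x}w_{xy}z_{xy}+\kappa_xz_x=\lambda\mu_xz'_x$ for all $x\in V$. Variational eigenvalues. $\mathcal S_p=\{f\in\mathbb R^V:\sum_x\mu_x|f(x)|^p=1\}$. For a compact set $S=-S$ its index (Krasnoselskii genus) $\gamma(S)$ is $0$ if $S=\emptyset$, otherwise the least positive integer $k$ for which an odd continuous map $S\to\mathbb R^k\setminus\{0\}$ exists ($\infty$ if none). $\mathcal F_k(\mathcal S_p)$ is the family of compact $A=-A\subset\mathcal S_p$ with $\gamma(A)\ge k$. With $\mathcal R_p^\sigma(f)=\frac{\sum_{\{x,y\}\in E}w_{xy}|f(x)-\sigma_{xy}f(y)|^p+\sum_{x\in V}\kappa_x|f(x)|^p}{\sum_{x\in V}\mu_x|f(x)|^p}$, set $\lambda_k=\inf_{S\in\mathcal F_k(\mathcal S_p)}\sup_{f\in S}\mathcal R_p^\sigma(f)$, $k=1,\dots,n$. Nodal domains. For a signature $s$ on $G$ and $f:V\to\mathbb R$: a sequence $x_1,\dots,x_m$ of vertices is a strong nodal domain walk of $f$ with respect to $(G,s)$ if $x_i\sim x_{i+1}$ and $f(x_i)s_{x_ix_{i+1}}f(x_{i+1})>0$ for all $i<m$. A walk $x_1,\dots,x_m$ ($m\ge2$, $x_i\sim x_{i+1}$) is a weak nodal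 domain walk if for all $i<j$ with $f(x_i)\ne0$, $f(x_j)\neq0$ and $f(x_\ell)=0$ for $i<\ell<j$ one has $f(x_i)s_{x_ix_{i+1}}\cdots s_{x_{j-1}x_j}f(x_j)>0$. On $\Omega=\{x:f(x)\ne0\}$ let $x,y$ be strongly (resp. weakly) equivalent if $x=y$ or a strong (resp. weak) nodal domain walk connects them. The number of strong (resp. weak) nodal domains of $f$ with respect to $(G,s)$ is the number of equivalence classes. $\overline{\mathfrak S}(f)$ (resp. $\overline{\mathfrak W}(f)$) is the number of strong (resp. weak) nodal domains of $f$ with respect to the opposite signed graph $(G,-\sigma)$. *)

theory Defs
  imports "HOL-Analysis.Analysis"
begin

text \<open>
  A graph on the vertex set \<open>UNIV :: 'v set\<close>, with \<open>'v\<close> finite, is given by its set \<open>E\<close> of edges,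
  each a two-element set of vertices. Edge weights \<open>w\<close> and signatures \<open>s\<close> are functions of the
  unordered edge, and only their values on \<open>E\<close> matter. Functions on the vertices are elements
  of \<open>real ^ 'v\<close>.
\<close>

definition simple_graph :: "'v set set \<Rightarrow> bool" where
  "simple_graph E \<longleftrightarrow> (\<forall>e\<in>E. card e = 2)"

definition signature_on :: "'v set set \<Rightarrow> ('v set \<Rightarrow> real) \<Rightarrow> bool" where
  "signature_on E s \<longleftrightarrow> (\<forall>e\<in>E. s e \<in> {-1, 1})"

definition Phi :: "real \<Rightarrow> real \<Rightarrow> real" where
  "Phi p t = (if t = 0 then 0 else \<bar>t\<bar> powr (p - 2) * t)"

definition Sgn :: "real \<Rightarrow> real set" where
  "Sgn t = (if t > 0 then {1} else if t = 0 then {-1..1} else {-1})"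

definition p_laplacian ::
  "real \<Rightarrow> 'v::finite set set \<Rightarrow> ('v set \<Rightarrow> real) \<Rightarrow> ('v \<Rightarrow> real) \<Rightarrow> ('v set \<Rightarrow> real)
    \<Rightarrow> real ^ 'v \<Rightarrow> 'v \<Rightarrow> real" where
  "p_laplacian p E w \<kappa> s f x =
    (\<Sum>y | {x, y} \<in> E. w {x, y} * Phi p (f $ x - s {x, y} * f $ y)) + \<kappa> x * Phi p (f $ x)"

definition eigenfunction_1 ::
  "'v::finite set set \<Rightarrow> ('v set \<Rightarrow> real) \<Rightarrow> ('v \<Rightarrow> real) \<Rightarrow> ('v \<Rightarrow> real) \<Rightarrow> ('v set \<Rightarrow> real)
    \<Rightarrow> real \<Rightarrow> real ^ 'v \<Rightarrow> bool" where
  "eigenfunction_1 E w \<mu> \<kappa> s lam f \<longleftrightarrow> f \<noteq> 0 \<and>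
    (\<exists>(z :: 'v \<Rightarrow> 'v \<Rightarrow> real) (a :: 'v \<Rightarrow> real) (b :: 'v \<Rightarrow> real).
      (\<forall>x y. {x, y} \<in> E \<longrightarrow>
        z x y \<in> Sgn (f $ x - s {x, y} * f $ y) \<and> z x y = - s {x, y} * z y x) \<and>
      (\<forall>x. a x \<in> Sgn (f $ x) \<and> b x \<in> Sgn (f $ x)) \<and>
      (\<forall>x. (\<Sum>y | {x, y} \<in> E. w {x, y} * z x y) + \<kappa> x * a x = lam * \<mu> x * b x))"

text \<open>Meaningful for \<open>p \<ge> 1\<close> only.\<close>

definition eigenfunction ::
  "real \<Rightarrow> 'v::finite set set \<Rightarrow> ('v set \<Rightarrow> real) \<Rightarrow> ('v \<Rightarrow> real) \<Rightarrow> ('v \<Rightarrow> real)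
    \<Rightarrow> ('v set \<Rightarrow> real) \<Rightarrow> real \<Rightarrow> real ^ 'v \<Rightarrow> bool" where
  "eigenfunction p E w \<mu> \<kappa> s lam f \<longleftrightarrow>
    (if p = 1 then eigenfunction_1 E w \<mu> \<kappa> s lam f
     else f \<noteq> 0 \<and> (\<forall>x. p_laplacian p E w \<kappa> s f x = lam * \<mu> x * Phi p (f $ x)))"

text \<open>
  The quantity \<open>\<bar>f x - s\<^sub>x\<^sub>y f y\<bar>\<close> of an unordered edge: it does not depend on the orientation
  because \<open>s\<^sub>x\<^sub>y = \<plusminus>1\<close>, see \<open>edge_diff_doubleton\<close>.
\<close>

definition edge_diff :: "('v::finite set \<Rightarrow> real) \<Rightarrow> real ^ 'v \<Rightarrow> 'v set \<Rightarrow> real" where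
  "edge_diff s f e = (THE r. \<exists>x y. e = {x, y} \<and> r = \<bar>f $ x - s e * f $ y\<bar>)"

lemma edge_diff_doubleton:
  fixes f :: "real ^ 'v::finite"
  assumes "s {x, y} \<in> {-1, 1}"
  shows "edge_diff s f {x, y} = \<bar>f $ x - s {x, y} * f $ y\<bar>"
  unfolding edge_diff_def
  by (rule the_equality) (use assms in \<open>auto simp: doubleton_eq_iff\<close>)

definition rayleigh ::
  "real \<Rightarrow> 'v::finite set set \<Rightarrow> ('v set \<Rightarrow> real) \<Rightarrow> ('v \<Rightarrow> real) \<Rightarrow> ('v \<Rightarrow> real)
    \<Rightarrow> ('v set \<Rightarrow> real) \<Rightarrow> real ^ 'v \<Rightarrow> real" where
  "rayleigh p E w \<mu> \<kappa> s f =
    ((\<Sum>e\<in>E. w e * edge_diff s f e powr p) + (\<Sum>x\<in>UNIV. \<kappa> x * \<bar>f $ x\<bar> powr p))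
      / (\<Sum>x\<in>UNIV. \<mu> x * \<bar>f $ x\<bar> powr p)"

definition p_sphere :: "real \<Rightarrow> ('v::finite \<Rightarrow> real) \<Rightarrow> (real ^ 'v) set" where
  "p_sphere p \<mu> = {f. (\<Sum>x\<in>UNIV. \<mu> x * \<bar>f $ x\<bar> powr p) = 1}"

text \<open>
  Existence of an odd continuous map \<open>S \<rightarrow> \<real>\<^sup>k \<setminus> {0}\<close>. Since \<open>k\<close> varies, \<open>\<real>\<^sup>k\<close> is the topological
  space \<open>Euclidean_space k\<close> of real sequences vanishing from index \<open>k\<close> on.
\<close>

definition odd_map_to :: "nat \<Rightarrow> 'a::real_normed_vector set \<Rightarrow> bool" where
  "odd_map_to k S \<longleftrightarrow> (\<exists>g.
    continuous_map (top_of_set S) (subtopology (Euclidean_space k) (- {\<lambda>i. 0})) g \<and>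
    (\<forall>x\<in>S. \<forall>i. g (- x) i = - g x i))"

definition genus :: "'a::real_normed_vector set \<Rightarrow> enat" where
  "genus S =
    (if S = {} then 0
     else if \<exists>k\<ge>1. odd_map_to k S then enat (LEAST k. 1 \<le> k \<and> odd_map_to k S)
     else \<infinity>)"

definition genus_family :: "nat \<Rightarrow> 'a::real_normed_vector set \<Rightarrow> 'a set set" where
  "genus_family k X = {A. compact A \<and> uminus ` A = A \<and> A \<subseteq> X \<and> enat k \<le> genus A}"

text \<open>
  The infimum and supremum are taken in the extended reals, so that no side condition
  (nonemptiness, boundedness) is needed for them to have their usual meaning.
\<close>

definition variational_eigenvalue ::
  "real \<Rightarrow> 'v::finite set set \<Rightarrow> ('v set \<Rightarrow> real) \<Rightarrow> ('v \<Rightarrow> real) \<Rightarrow> ('v \<Rightarrow> real)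
    \<Rightarrow> ('v set \<Rightarrow> real) \<Rightarrow> nat \<Rightarrow> ereal" where
  "variational_eigenvalue p E w \<mu> \<kappa> s k =
    (INF S \<in> genus_family k (p_sphere p \<mu>). SUP f \<in> S. ereal (rayleigh p E w \<mu> \<kappa> s f))"

definition walk :: "'v set set \<Rightarrow> 'v list \<Rightarrow> bool" where
  "walk E xs \<longleftrightarrow> xs \<noteq> [] \<and> (\<forall>i. Suc i < length xs \<longrightarrow> {xs ! i, xs ! Suc i} \<in> E)"

definition strong_nodal_walk ::
  "'v::finite set set \<Rightarrow> ('v set \<Rightarrow> real) \<Rightarrow> real ^ 'v \<Rightarrow> 'v list \<Rightarrow> bool" where
  "strong_nodal_walk E s f xs \<longleftrightarrow> walk E xs \<and>
    (\<forall>i. Suc i < length xs \<longrightarrow>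
      f $ (xs ! i) * s {xs ! i, xs ! Suc i} * f $ (xs ! Suc i) > 0)"

definition weak_nodal_walk ::
  "'v::finite set set \<Rightarrow> ('v set \<Rightarrow> real) \<Rightarrow> real ^ 'v \<Rightarrow> 'v list \<Rightarrow> bool" where
  "weak_nodal_walk E s f xs \<longleftrightarrow> walk E xs \<and> 2 \<le> length xs \<and>
    (\<forall>i j. i < j \<and> j < length xs \<and> f $ (xs ! i) \<noteq> 0 \<and> f $ (xs ! j) \<noteq> 0 \<and>
        (\<forall>l. i < l \<and> l < j \<longrightarrow> f $ (xs ! l) = 0) \<longrightarrow>
      f $ (xs ! i) * (\<Prod>l\<in>{i..<j}. s {xs ! l, xs ! Suc l}) * f $ (xs ! j) > 0)"

definition nonzeros :: "real ^ 'v::finite \<Rightarrow> 'v set" where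
  "nonzeros f = {x. f $ x \<noteq> 0}"

definition connection :: "('v list \<Rightarrow> bool) \<Rightarrow> 'v set \<Rightarrow> ('v \<times> 'v) set" where
  "connection W \<Omega> =
    {(x, y) \<in> \<Omega> \<times> \<Omega>. x = y \<or> (\<exists>xs. W xs \<and> hd xs = x \<and> last xs = y)}"

definition strong_nodal_count ::
  "'v::finite set set \<Rightarrow> ('v set \<Rightarrow> real) \<Rightarrow> real ^ 'v \<Rightarrow> nat" where
  "strong_nodal_count E s f =
    card (nonzeros f // connection (strong_nodal_walk E s f) (nonzeros f))"

definition weak_nodal_count ::
  "'v::finite set set \<Rightarrow> ('v set \<Rightarrow> real) \<Rightarrow> real ^ 'v \<Rightarrow> nat" where
  "weak_nodal_count E s f =
    card (nonzeros f // connection (weak_nodal_walk E s f) (nonzeros f))"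

definition dual_strong_nodal_count ::
  "'v::finite set set \<Rightarrow> ('v set \<Rightarrow> real) \<Rightarrow> real ^ 'v \<Rightarrow> nat" where
  "dual_strong_nodal_count E s f = strong_nodal_count E (\<lambda>e. - s e) f"

definition dual_weak_nodal_count ::
  "'v::finite set set \<Rightarrow> ('v set \<Rightarrow> real) \<Rightarrow> real ^ 'v \<Rightarrow> nat" where
  "dual_weak_nodal_count E s f = weak_nodal_count E (\<lambda>e. - s e) f"

end

theory Submission
  imports Defs
begin

text \<open>
  Let \<open>m\<close> be the number of dual strong nodal domains of \<open>f\<close>. The functions \<open>t f\<close>, where \<open>t\<close> is
  constant on each of these domains, form a linear space \<open>W\<close> of dimension \<open>m\<close>, and the bound
  \<open>m \<le> n - k\<close> follows from two facts about \<open>W\<close>.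

  \<^item> Energy: the Rayleigh quotient is at least \<open>\<lambda>\<close> at all nonzero \<open>g \<in> W\<close> (\<open>energy_ge_of_const_on_domains\<close>).
    To see it, multiply the eigenvalue equation at \<open>x\<close> by \<open>\<bar>t x\<bar>\<^sup>p f x\<close> and sum over \<open>x\<close>. The claim
    becomes an inequality for each single edge. Write \<open>u = f x\<close> and \<open>v = \<sigma>\<^sub>x\<^sub>y f y\<close>. If \<open>u v < 0\<close>,
    then \<open>x\<close> and \<open>y\<close> lie in the same dual domain, so \<open>t x = t y\<close> and there is equality. If
    \<open>u v \<ge> 0\<close>, the inequality is \<open>picone_edge_inequality\<close>, a discrete Picone inequality; it
    expresses the convexity of \<open>\<bar>\<cdot>\<bar>\<^sup>p\<close>.

  \<^item> Intersection: \<open>W\<close> is cut out by \<open>n - m\<close> linear equations. If \<open>n - m < k\<close>, a symmetric compact set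
    of genus at least \<open>k\<close> must contain a point of \<open>W\<close>, since otherwise the left-hand sides of the
    equations would form an odd continuous map into \<open>\<real>\<^sup>n\<^sup>-\<^sup>m \<setminus> {0}\<close> (\<open>genus_family_common_zero\<close>).

  Hence \<open>m > n - k\<close> would give \<open>\<lambda>\<^sub>k \<ge> \<lambda>\<close>. The exponent \<open>p = 1\<close> is covered by the same argument:
  all it takes from the eigenvalue equation is that \<open>\<Phi>\<^sub>p\<close> is replaced by subgradients of \<open>\<bar>\<cdot>\<bar>\<^sup>p / p\<close>,
  chosen consistently at the two ends of each edge.

  The comparison of weak with strong nodal domains holds because a strong nodal domain walk with at
  least two vertices never visits a zero of \<open>f\<close>, so that it is also a weak one: the weak equivalence
  is coarser.
\<close>

section \<open>Nodal domains as equivalence classes\<close>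

text \<open>
  The gluing vertex has to lie in \<open>\<Omega>\<close>: two weak nodal domain walks that meet at a zero of \<open>f\<close>
  need not form a weak nodal domain walk together.
\<close>

lemma equiv_connection:
  assumes rev: "\<And>xs. W xs \<Longrightarrow> W (rev xs)"
    and glue: "\<And>xs ys. W xs \<Longrightarrow> W ys \<Longrightarrow> last xs = hd ys \<Longrightarrow> hd ys \<in> \<Omega> \<Longrightarrow> W (xs @ tl ys)"
    and ne: "\<And>xs. W xs \<Longrightarrow> xs \<noteq> []"
  shows "equiv \<Omega> (connection W \<Omega>)"
proof (rule equivI)
  show "connection W \<Omega> \<subseteq> \<Omega> \<times> \<Omega>" "refl_on \<Omega> (connection W \<Omega>)"
    by (auto simp: connection_def refl_on_def)
  show "sym (connection W \<Omega>)"
  proof (rule symI)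
    fix x y assume "(x, y) \<in> connection W \<Omega>"
    moreover have "\<exists>ys. W ys \<and> hd ys = y \<and> last ys = x"
      if "W xs" "hd xs = x" "last xs = y" for xs
      using that rev[of xs] ne[of xs] by (metis hd_rev last_rev)
    ultimately show "(y, x) \<in> connection W \<Omega>"
      by (auto simp: connection_def)
  qed
  show "trans (connection W \<Omega>)"
  proof (rule transI)
    fix x y z assume xy: "(x, y) \<in> connection W \<Omega>" and yz: "(y, z) \<in> connection W \<Omega>"
    have "\<exists>zs. W zs \<and> hd zs = x \<and> last zs = z"
      if "W xs" "hd xs = x" "last xs = y" "W ys" "hd ys = y" "last ys = z" "y \<in> \<Omega>" for xs ys
    proof (intro exI conjI)
      show "W (xs @ tl ys)" using that glue by auto
      show "hd (xs @ tl ys) = x" using that ne[of xs] by simp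
      show "last (xs @ tl ys) = z"
        using that ne[of ys] ne[of xs] by (cases ys) (auto simp: last_append)
    qed
    with xy yz show "(x, z) \<in> connection W \<Omega>"
      by (auto simp: connection_def)
  qed
qed

lemma walk_nonempty: "walk E xs \<Longrightarrow> xs \<noteq> []"
  by (simp add: walk_def)

lemma nth_glue:
  assumes "xs \<noteq> []" "ys \<noteq> []" "last xs = hd ys"
  shows "i < length xs \<Longrightarrow> (xs @ tl ys) ! i = xs ! i"
    and "length xs - 1 \<le> i \<Longrightarrow> i < length xs + length ys - 1 \<Longrightarrow>
      (xs @ tl ys) ! i = ys ! (i - (length xs - 1))"
proof -
  show "i < length xs \<Longrightarrow> (xs @ tl ys) ! i = xs ! i"
    by (simp add: nth_append)
  assume i: "length xs - 1 \<le> i" "i < length xs + length ys - 1"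
  show "(xs @ tl ys) ! i = ys ! (i - (length xs - 1))"
  proof (cases "i = length xs - 1")
    case True
    then show ?thesis using assms by (simp add: nth_append last_conv_nth hd_conv_nth)
  next
    case False
    then have "\<not> i < length xs" "Suc (i - length xs) = i - (length xs - 1)"
      "i - length xs < length ys - 1"
      using i assms(1) by (cases xs; force)+
    then show ?thesis by (simp add: nth_append nth_tl)
  qed
qed

text \<open>
  A property of consecutive vertices passes from two walks to the glued walk, and a symmetric one to
  the reversed walk; this covers adjacency as well as the sign condition of strong walks.
\<close>

lemma steps_glue:
  assumes "xs \<noteq> []" "ys \<noteq> []" "last xs = hd ys"
    and "\<forall>i. Suc i < length xs \<longrightarrow> P (xs ! i) (xs ! Suc i)"
    and "\<forall>i. Suc i < length ys \<longrightarrow> P (ys ! i) (ys ! Suc i)"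
  shows "\<forall>i. Suc i < length (xs @ tl ys) \<longrightarrow> P ((xs @ tl ys) ! i) ((xs @ tl ys) ! Suc i)"
proof (intro allI impI)
  fix i assume i: "Suc i < length (xs @ tl ys)"
  show "P ((xs @ tl ys) ! i) ((xs @ tl ys) ! Suc i)"
  proof (cases "Suc i < length xs")
    case True
    then show ?thesis using assms(4) by (simp add: nth_append)
  next
    case False
    define j where "j = i - (length xs - 1)"
    have "(xs @ tl ys) ! i = ys ! j" "(xs @ tl ys) ! Suc i = ys ! Suc j" "Suc j < length ys"
      using False i assms(1,2) nth_glue(2)[OF assms(1-3), of i] nth_glue(2)[OF assms(1-3), of "Suc i"]
      by (auto simp: j_def Suc_diff_le)
    then show ?thesis using assms(5) by simp
  qed
qed

lemma steps_rev:
  assumes "\<forall>i. Suc i < length xs \<longrightarrow> P (xs ! i) (xs ! Suc i)" and "\<And>x y. P x y \<Longrightarrow> P y x"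
  shows "\<forall>i. Suc i < length (rev xs) \<longrightarrow> P (rev xs ! i) (rev xs ! Suc i)"
proof (intro allI impI)
  fix i assume "Suc i < length (rev xs)"
  moreover from this have "Suc (length xs - Suc (Suc i)) = length xs - Suc i" by simp
  ultimately show "P (rev xs ! i) (rev xs ! Suc i)"
    using assms(1)[rule_format, of "length xs - Suc (Suc i)"] assms(2) by (simp add: rev_nth)
qed

lemma walk_glue: "walk E xs \<Longrightarrow> walk E ys \<Longrightarrow> last xs = hd ys \<Longrightarrow> walk E (xs @ tl ys)"
  using steps_glue[of xs ys "\<lambda>x y. {x, y} \<in> E"] by (auto simp: walk_def)

lemma walk_rev: "walk E xs \<Longrightarrow> walk E (rev xs)"
  using steps_rev[of xs "\<lambda>x y. {x, y} \<in> E"] by (auto simp: walk_def insert_commute)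

lemma equiv_strong_nodal:
  "equiv (nonzeros f) (connection (strong_nodal_walk E s f) (nonzeros f))"
proof (rule equiv_connection)
  fix xs assume "strong_nodal_walk E s f xs"
  then show "strong_nodal_walk E s f (rev xs)"
    using steps_rev[of xs "\<lambda>x y. f $ x * s {x, y} * f $ y > 0"] walk_rev[of E xs]
    by (auto simp: strong_nodal_walk_def insert_commute mult_ac)
next
  fix xs ys assume "strong_nodal_walk E s f xs" "strong_nodal_walk E s f ys" "last xs = hd ys"
  then show "strong_nodal_walk E s f (xs @ tl ys)"
    using steps_glue[of xs ys "\<lambda>x y. f $ x * s {x, y} * f $ y > 0"] walk_glue[of E xs ys]
    by (auto simp: strong_nodal_walk_def walk_nonempty)
qed (auto simp: strong_nodal_walk_def walk_def)

lemma weak_nodal_walkI: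
  assumes "walk E xs" "2 \<le> length xs"
    and "\<And>i j. i < j \<Longrightarrow> j < length xs \<Longrightarrow> f $ (xs ! i) \<noteq> 0 \<Longrightarrow> f $ (xs ! j) \<noteq> 0 \<Longrightarrow>
      \<forall>l. i < l \<and> l < j \<longrightarrow> f $ (xs ! l) = 0 \<Longrightarrow>
      f $ (xs ! i) * (\<Prod>l\<in>{i..<j}. s {xs ! l, xs ! Suc l}) * f $ (xs ! j) > 0"
  shows "weak_nodal_walk E s f xs"
  unfolding weak_nodal_walk_def
proof (intro conjI allI impI)
  fix i j
  assume "i < j \<and> j < length xs \<and> f $ (xs ! i) \<noteq> 0 \<and> f $ (xs ! j) \<noteq> 0 \<and>
    (\<forall>l. i < l \<and> l < j \<longrightarrow> f $ (xs ! l) = 0)"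
  then show "f $ (xs ! i) * (\<Prod>l\<in>{i..<j}. s {xs ! l, xs ! Suc l}) * f $ (xs ! j) > 0"
    by (elim conjE) (rule assms(3))
qed (fact assms)+

lemma weak_nodal_walkD:
  assumes "weak_nodal_walk E s f xs"
  shows "walk E xs" "2 \<le> length xs"
    and "i < j \<Longrightarrow> j < length xs \<Longrightarrow> f $ (xs ! i) \<noteq> 0 \<Longrightarrow> f $ (xs ! j) \<noteq> 0 \<Longrightarrow>
      \<forall>l. i < l \<and> l < j \<longrightarrow> f $ (xs ! l) = 0 \<Longrightarrow>
      f $ (xs ! i) * (\<Prod>l\<in>{i..<j}. s {xs ! l, xs ! Suc l}) * f $ (xs ! j) > 0"
  using assms by (simp_all add: weak_nodal_walk_def)

lemma weak_nodal_walk_rev: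
  assumes "weak_nodal_walk E s f xs"
  shows "weak_nodal_walk E s f (rev xs)"
proof -
  define n where "n = length xs"
  show ?thesis
  proof (rule weak_nodal_walkI)
    show "walk E (rev xs)" "2 \<le> length (rev xs)"
      using weak_nodal_walkD[OF assms] walk_rev by auto
    fix i j
    assume ij: "i < j" "j < length (rev xs)"
      and nz: "f $ (rev xs ! i) \<noteq> 0" "f $ (rev xs ! j) \<noteq> 0"
      and z: "\<forall>l. i < l \<and> l < j \<longrightarrow> f $ (rev xs ! l) = 0"
    from ij have ij: "i < j" "j < n" by (simp_all add: n_def)
    let ?i = "n - Suc i" and ?j = "n - Suc j"
    have r: "rev xs ! l = xs ! (n - Suc l)" if "l < n" for l
      using that by (simp add: rev_nth n_def)
    have "f $ (xs ! l) = 0" if "?j < l" "l < ?i" for l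
    proof -
      have "i < n - Suc l" "n - Suc l < j" "n - Suc (n - Suc l) = l" "n - Suc l < n"
        using that ij by auto
      then show ?thesis using z r[of "n - Suc l"] by auto
    qed
    then have zero: "\<forall>l. ?j < l \<and> l < ?i \<longrightarrow> f $ (xs ! l) = 0" by blast
    have "f $ (xs ! ?j) * (\<Prod>l\<in>{?j..<?i}. s {xs ! l, xs ! Suc l}) * f $ (xs ! ?i) > 0"
    proof -
      have "?j < ?i" "?i < n" "f $ (xs ! ?i) \<noteq> 0" "f $ (xs ! ?j) \<noteq> 0"
        using ij nz r[of i] r[of j] by auto
      then show ?thesis
        using zero unfolding n_def by (intro weak_nodal_walkD(3)[OF assms])
    qed
    moreover have "(\<Prod>l\<in>{?j..<?i}. s {xs ! l, xs ! Suc l})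
        = (\<Prod>l\<in>{i..<j}. s {rev xs ! l, rev xs ! Suc l})"
    proof (rule prod.reindex_bij_witness[of _ "\<lambda>l. n - Suc (Suc l)" "\<lambda>l. n - Suc (Suc l)"])
      fix l assume l: "l \<in> {?j..<?i}"
      have "n - Suc (n - Suc (Suc l)) = Suc l" "n - Suc (Suc (n - Suc (Suc l))) = l"
        "n - Suc (Suc l) < n" "Suc (n - Suc (Suc l)) < n"
        using l by auto
      then show "s {rev xs ! (n - Suc (Suc l)), rev xs ! Suc (n - Suc (Suc l))}
          = s {xs ! l, xs ! Suc l}"
        by (simp only: r insert_commute)
    qed (use ij in auto)
    ultimately show "f $ (rev xs ! i) * (\<Prod>l\<in>{i..<j}. s {rev xs ! l, rev xs ! Suc l})
        * f $ (rev xs ! j) > 0"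
      using ij r[of i] r[of j] by (simp only: mult_ac)
  qed
qed

lemma weak_nodal_walk_glue:
  assumes "weak_nodal_walk E s f xs" "weak_nodal_walk E s f ys" "last xs = hd ys"
    and nz: "f $ (hd ys) \<noteq> 0"
  shows "weak_nodal_walk E s f (xs @ tl ys)"
proof -
  define zs m where "zs = xs @ tl ys" and "m = length xs - 1"
  have ne: "xs \<noteq> []" "ys \<noteq> []"
    using assms(1,2)[THEN weak_nodal_walkD(1)] by (auto dest: walk_nonempty)
  have len: "length zs = m + length ys" "length xs = Suc m"
    using ne by (cases xs; cases ys; auto simp: zs_def m_def)+
  have l: "zs ! i = xs ! i" if "i \<le> m" for i
    using nth_glue(1)[OF ne assms(3)] that len by (simp add: zs_def)
  have r: "zs ! (m + i) = ys ! i" if "i < length ys" for i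
    using nth_glue(2)[OF ne assms(3), of "m + i"] that len by (simp add: zs_def)
  have mid: "f $ (zs ! m) \<noteq> 0"
    using r[of 0] ne nz by (simp add: hd_conv_nth)
  have "weak_nodal_walk E s f zs"
  proof (rule weak_nodal_walkI)
    show "walk E zs" "2 \<le> length zs"
      using walk_glue[OF assms(1,2)[THEN weak_nodal_walkD(1)] assms(3)] weak_nodal_walkD(2)[OF assms(1)]
      by (simp_all add: zs_def)
    fix i j
    assume ij: "i < j" "j < length zs" and nzij: "f $ (zs ! i) \<noteq> 0" "f $ (zs ! j) \<noteq> 0"
      and z: "\<forall>l. i < l \<and> l < j \<longrightarrow> f $ (zs ! l) = 0"
    \<comment> \<open>The gluing vertex is not a zero, so it does not lie strictly between \<open>i\<close> and \<open>j\<close>.\<close>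
    consider "j \<le> m" | "m \<le> i" using z mid by force
    then show "f $ (zs ! i) * (\<Prod>l\<in>{i..<j}. s {zs ! l, zs ! Suc l}) * f $ (zs ! j) > 0"
    proof cases
      case 1
      have "f $ (xs ! i) * (\<Prod>l\<in>{i..<j}. s {xs ! l, xs ! Suc l}) * f $ (xs ! j) > 0"
        using ij 1 nzij z len l by (intro weak_nodal_walkD(3)[OF assms(1)]) auto
      moreover have "(\<Prod>l\<in>{i..<j}. s {zs ! l, zs ! Suc l}) = (\<Prod>l\<in>{i..<j}. s {xs ! l, xs ! Suc l})"
        using 1 l by (intro prod.cong) auto
      ultimately show ?thesis using 1 ij l by simp
    next
      case 2
      define a b where "a = i - m" and "b = j - m"
      have ab: "i = m + a" "j = m + b" "a < b" "b < length ys"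
        using 2 ij len by (auto simp: a_def b_def)
      have za: "f $ (ys ! c) = 0" if "a < c" "c < b" for c
        using z[rule_format, of "m + c"] that ab r[of c] by simp
      have "f $ (ys ! a) * (\<Prod>l\<in>{a..<b}. s {ys ! l, ys ! Suc l}) * f $ (ys ! b) > 0"
        using ab nzij za r[of a] r[of b] by (intro weak_nodal_walkD(3)[OF assms(2)]) auto
      moreover have "(\<Prod>l\<in>{i..<j}. s {zs ! l, zs ! Suc l}) = (\<Prod>l\<in>{a..<b}. s {ys ! l, ys ! Suc l})"
      proof (rule prod.reindex_bij_witness[of _ "\<lambda>l. m + l" "\<lambda>l. l - m"])
        fix l assume l: "l \<in> {i..<j}"
        then have "ys ! (l - m) = zs ! l" "ys ! Suc (l - m) = zs ! Suc l"
          using r[of "l - m"] r[of "Suc (l - m)"] ab by auto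
        then show "s {ys ! (l - m), ys ! Suc (l - m)} = s {zs ! l, zs ! Suc l}" by simp
      qed (use ab in auto)
      ultimately show ?thesis using ab r[of a] r[of b] by simp
    qed
  qed
  then show ?thesis by (simp only: zs_def)
qed

lemma equiv_weak_nodal:
  "equiv (nonzeros f) (connection (weak_nodal_walk E s f) (nonzeros f))"
proof (rule equiv_connection)
  fix xs ys
  assume xs: "weak_nodal_walk E s f xs"
  show "weak_nodal_walk E s f (rev xs)"
    using xs by (rule weak_nodal_walk_rev)
  show "xs \<noteq> []"
    using weak_nodal_walkD(1)[OF xs] by (rule walk_nonempty)
  assume ys: "weak_nodal_walk E s f ys" "last xs = hd ys" and "hd ys \<in> nonzeros f"
  then have "f $ (hd ys) \<noteq> 0" by (simp add: nonzeros_def)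
  with ys show "weak_nodal_walk E s f (xs @ tl ys)"
    by (rule weak_nodal_walk_glue[OF xs])
qed

lemma strong_nodal_walk_imp_weak:
  assumes "strong_nodal_walk E s f xs" "2 \<le> length xs"
  shows "weak_nodal_walk E s f xs"
proof -
  have walk: "walk E xs"
    using assms(1) by (simp add: strong_nodal_walk_def)
  show ?thesis
  proof (rule weak_nodal_walkI[OF walk assms(2)])
    fix i j assume ij: "i < j" "j < length xs" and z: "\<forall>l. i < l \<and> l < j \<longrightarrow> f $ (xs ! l) = 0"
    have step: "f $ (xs ! i) * s {xs ! i, xs ! Suc i} * f $ (xs ! Suc i) > 0"
      using assms(1) ij by (auto simp: strong_nodal_walk_def)
    \<comment> \<open>No zeros occur on the walk, so \<open>i\<close> and \<open>j\<close> are consecutive.\<close>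
    then have "f $ (xs ! Suc i) \<noteq> 0" by auto
    then have "j = Suc i" using z ij by (metis Suc_lessI lessI)
    then show "f $ (xs ! i) * (\<Prod>l\<in>{i..<j}. s {xs ! l, xs ! Suc l}) * f $ (xs ! j) > 0"
      using step by simp
  qed
qed

lemma connection_strong_subset_weak:
  "connection (strong_nodal_walk E s f) \<Omega> \<subseteq> connection (weak_nodal_walk E s f) \<Omega>"
proof -
  have "hd xs = last xs \<or> weak_nodal_walk E s f xs" if "strong_nodal_walk E s f xs" for xs
  proof (cases "2 \<le> length xs")
    case True
    then show ?thesis using that strong_nodal_walk_imp_weak by blast
  next
    case False
    moreover have "xs \<noteq> []" using that by (auto simp: strong_nodal_walk_def walk_def)
    ultimately obtain a where "xs = [a]" by (cases xs) (auto simp: not_le)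
    then show ?thesis by simp
  qed
  then show ?thesis unfolding connection_def by blast
qed

lemma card_quotient_mono:
  assumes "finite A" "equiv A R" "equiv A S" "R \<subseteq> S"
  shows "card (A // S) \<le> card (A // R)"
proof -
  \<comment> \<open>\<open>S `` C\<close> is the \<open>S\<close>-class that contains the \<open>R\<close>-class \<open>C\<close>.\<close>
  have "A // S \<subseteq> (\<lambda>C. S `` C) ` (A // R)"
  proof
    fix C assume "C \<in> A // S"
    then obtain x where x: "x \<in> A" "C = S `` {x}" by (rule quotientE)
    have "S `` (R `` {x}) \<subseteq> S `` {x}"
    proof
      fix y assume "y \<in> S `` (R `` {x})"
      then obtain z where "(x, z) \<in> S" "(z, y) \<in> S"
        using assms(4) by blast
      then show "y \<in> S `` {x}"
        using assms(3) by (auto elim: equivE dest: transD)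
    qed
    moreover have "S `` {x} \<subseteq> S `` (R `` {x})"
      using equiv_class_self[OF assms(2) x(1)] by blast
    ultimately have "C = S `` (R `` {x})"
      using x(2) by blast
    then show "C \<in> (\<lambda>C. S `` C) ` (A // R)"
      using quotientI[OF x(1), of R] by blast
  qed
  moreover have "finite (A // R)"
    using assms(1) by (simp add: quotient_def)
  ultimately show ?thesis by (meson surj_card_le)
qed

lemma weak_nodal_count_le_strong_nodal_count:
  "weak_nodal_count E s f \<le> strong_nodal_count E s f"
  unfolding weak_nodal_count_def strong_nodal_count_def
  by (intro card_quotient_mono equiv_strong_nodal equiv_weak_nodal connection_strong_subset_weak) simp

lemma same_strong_domain_of_edge:
  assumes "{x, y} \<in> E" "f $ x * s {x, y} * f $ y > 0"
  shows "(x, y) \<in> connection (strong_nodal_walk E s f) (nonzeros f)"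
proof -
  have "strong_nodal_walk E s f [x, y]"
    using assms by (auto simp: strong_nodal_walk_def walk_def less_Suc_eq)
  then show ?thesis
    using assms by (force simp: connection_def nonzeros_def)
qed

lemma quotient_representatives:
  assumes "equiv A R"
  obtains r where "\<forall>x\<in>A. r x \<in> A" "\<forall>x y. (x, y) \<in> R \<longrightarrow> r x = r y"
    "\<forall>x\<in>A. r (r x) = r x" "card (r ` A) = card (A // R)"
proof -
  define c where "c C = (SOME y. y \<in> C)" for C :: "'a set"
  define r where "r x = c (R `` {x})" for x
  have c: "c C \<in> C" if "C \<in> A // R" for C
    using in_quotient_imp_non_empty[OF assms that] unfolding c_def by (simp add: some_in_eq)
  have 0: "(x, r x) \<in> R" if "x \<in> A" for x
    using c[OF quotientI[OF that]] by (simp add: r_def)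
  have 1: "r x \<in> A" if "x \<in> A" for x
    using 0[OF that] assms by (auto simp: equiv_def)
  have 2: "r x = r y" if "(x, y) \<in> R" for x y
    using equiv_class_eq[OF assms that] by (simp add: r_def)
  have 3: "r (r x) = r x" if "x \<in> A" for x
    using 2[OF 0[OF that]] by simp
  have "inj_on c (A // R)"
    using c quotient_disj[OF assms] by (intro inj_onI) (metis IntI empty_iff)
  moreover have "r ` A = c ` (A // R)"
    by (auto simp: r_def quotient_def)
  ultimately have "card (r ` A) = card (A // R)"
    by (simp add: card_image)
  with that 1 2 3 show thesis by blast
qed

section \<open>The genus and linear equations\<close>

text \<open>
  Without a common zero in \<open>S\<close>, the functions \<open>L i\<close> would be the components of an odd continuous map
  from \<open>S\<close> to the nonzero vectors of dimension \<open>card N\<close>, and the genus of \<open>S\<close> would be at most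
  \<open>card N\<close>.
\<close>

lemma genus_family_common_zero:
  fixes L :: "'i \<Rightarrow> 'a::real_normed_vector \<Rightarrow> real"
  assumes S: "S \<in> genus_family k X" and N: "finite N" "card N < k"
    and cont: "\<And>i. i \<in> N \<Longrightarrow> continuous_on S (L i)"
    and odd: "\<And>i x. i \<in> N \<Longrightarrow> L i (- x) = - L i x"
  shows "\<exists>x\<in>S. \<forall>i\<in>N. L i x = 0"
proof (rule ccontr)
  assume none: "\<not> ?thesis"
  have genus: "enat k \<le> genus S" using S by (simp add: genus_family_def)
  have S_ne: "S \<noteq> {}"
    using genus N by (auto simp: genus_def zero_enat_def)
  then have N_ne: "card N \<ge> 1"
    using none N by (auto simp: Suc_le_eq card_gt_0_iff)
  obtain e where e: "bij_betw e {0..<card N} N"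
    using ex_bij_betw_nat_finite[OF N(1)] by blast
  define g where "g x i = (if i < card N then L (e i) x else 0)" for x i
  have e_N: "e i \<in> N" if "i < card N" for i
    using e that by (auto simp: bij_betw_def)
  have "continuous_map (top_of_set S) euclideanreal (\<lambda>x. g x i)" for i
    using cont e_N by (cases "i < card N") (auto simp: g_def)
  moreover have "g x \<noteq> (\<lambda>i. 0)" if "x \<in> S" for x
  proof
    assume "g x = (\<lambda>i. 0)"
    then have "L (e i) x = 0" if "i < card N" for i
      using that by (metis g_def)
    then have "\<forall>j\<in>N. L j x = 0"
      using e by (force simp: bij_betw_def)
    with none that show False by blast
  qed
  ultimately have "continuous_map (top_of_set S) (subtopology (Euclidean_space (card N)) (- {\<lambda>i. 0})) g"
    by (auto simp: Euclidean_space_def continuous_map_in_subtopology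
        continuous_map_componentwise_UNIV g_def)
  moreover have "g (- x) i = - g x i" for x i
    using odd e_N by (simp add: g_def)
  ultimately have "odd_map_to (card N) S"
    unfolding odd_map_to_def by blast
  then have "genus S \<le> enat (card N)"
    using N_ne S_ne by (auto simp: genus_def intro: Least_le)
  with genus N show False
    by (meson enat_ord_simps(1) leD order_trans)
qed

section \<open>A Picone inequality on edges\<close>

lemma abs_powr_convex:
  fixes x y \<theta> p :: real
  assumes "p \<ge> 1" "0 \<le> \<theta>" "\<theta> \<le> 1"
  shows "\<bar>\<theta> * x + (1 - \<theta>) * y\<bar> powr p \<le> \<theta> * \<bar>x\<bar> powr p + (1 - \<theta>) * \<bar>y\<bar> powr p"
proof -
  have shrink: "(c * a) powr p \<le> c * a powr p" if "0 \<le> c" "c \<le> 1" "0 \<le> a" for c a :: real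
  proof -
    have "c powr p \<le> c powr 1" using that assms powr_mono'[of 1 p c] by simp
    then show ?thesis using that by (simp add: powr_mult mult_right_mono)
  qed
  have "\<bar>\<theta> * x + (1 - \<theta>) * y\<bar> \<le> \<theta> * \<bar>x\<bar> + (1 - \<theta>) * \<bar>y\<bar>"
    using abs_triangle_ineq[of "\<theta> * x" "(1 - \<theta>) * y"] assms by (simp add: abs_mult)
  then have "\<bar>\<theta> * x + (1 - \<theta>) * y\<bar> powr p \<le> (\<theta> * \<bar>x\<bar> + (1 - \<theta>) * \<bar>y\<bar>) powr p"
    using assms by (intro powr_mono2) auto
  also have "\<dots> \<le> \<theta> * \<bar>x\<bar> powr p + (1 - \<theta>) * \<bar>y\<bar> powr p"
  proof (cases "x = 0 \<or> y = 0")
    case True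
    then show ?thesis
      using shrink[of \<theta> "\<bar>x\<bar>"] shrink[of "1 - \<theta>" "\<bar>y\<bar>"] assms by auto
  next
    case False
    then show ?thesis
      using convex_onD[OF powr_convex[OF assms(1)], of "1 - \<theta>" "\<bar>x\<bar>" "\<bar>y\<bar>"] assms by simp
  qed
  finally show ?thesis .
qed

text \<open>The subdifferential of \<open>\<bar>\<cdot>\<bar>\<^sup>p / p\<close>, for \<open>p \<ge> 1\<close>.\<close>

definition power_subgrad :: "real \<Rightarrow> real \<Rightarrow> real set" where
  "power_subgrad p t = (if p = 1 then Sgn t else {Phi p t})"

lemma power_subgrad_pos:
  assumes "t > 0" shows "power_subgrad p t = {t powr (p - 1)}"
proof -
  have "t powr (p - 2) * t = t powr (p - 1)"
    using assms powr_add[of t "p - 2" 1] by simp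
  with assms show ?thesis by (simp add: power_subgrad_def Sgn_def Phi_def)
qed

lemma power_subgrad_uminus: "z \<in> power_subgrad p t \<Longrightarrow> - z \<in> power_subgrad p (- t)"
  by (auto simp: power_subgrad_def Sgn_def Phi_def split: if_splits)

lemma power_subgrad_mult_self:
  assumes "z \<in> power_subgrad p t"
  shows "z * t = \<bar>t\<bar> powr p"
proof -
  have pos: "z * t = \<bar>t\<bar> powr p" if "z \<in> power_subgrad p t" "t > 0" for z t
    using that powr_add[of t "p - 1" 1] by (simp add: power_subgrad_pos)
  show ?thesis
    using pos[of z t] pos[of "- z" "- t"] power_subgrad_uminus[OF assms] assms
    by (cases t "0 :: real" rule: linorder_cases) auto
qed

text \<open>
  For \<open>u > v \<ge> 0\<close> the number \<open>t\<close> is the convex combination of \<open>s\<close> and \<open>(t u - s v) / (u - v)\<close> with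
  coefficients \<open>v / u\<close> and \<open>(u - v) / u\<close>. Convexity of \<open>\<bar>\<cdot>\<bar>\<^sup>p\<close>, multiplied by \<open>u (u - v)\<^sup>p\<^sup>-\<^sup>1\<close>, is the claim.
\<close>

lemma picone_edge_inequality_aux:
  fixes u v t s p :: real
  assumes "p \<ge> 1" "v \<ge> 0" "u > v"
  shows "(\<bar>t\<bar> powr p * u - \<bar>s\<bar> powr p * v) * (u - v) powr (p - 1) \<le> \<bar>t * u - s * v\<bar> powr p"
proof -
  define r where "r = (t * u - s * v) / (u - v)"
  have u: "u > 0" using assms by simp
  have rd: "(u - v) * r = t * u - s * v"
    using assms by (simp add: r_def)
  have "u * (v / u * s + (1 - v / u) * r) = v * s + (u - v) * r"
    using u by (simp add: field_simps)
  also have "\<dots> = u * t" by (simp add: rd)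
  finally have t: "v / u * s + (1 - v / u) * r = t" using u by simp
  have "\<bar>t\<bar> powr p \<le> v / u * \<bar>s\<bar> powr p + (1 - v / u) * \<bar>r\<bar> powr p"
    using abs_powr_convex[of p "v / u" s r] assms t by simp
  then have "u * \<bar>t\<bar> powr p \<le> u * (v / u * \<bar>s\<bar> powr p + (1 - v / u) * \<bar>r\<bar> powr p)"
    using u by (intro mult_left_mono) auto
  also have "\<dots> = v * \<bar>s\<bar> powr p + (u - v) * \<bar>r\<bar> powr p"
    using u by (simp add: field_simps)
  finally have "(\<bar>t\<bar> powr p * u - \<bar>s\<bar> powr p * v) * (u - v) powr (p - 1)
      \<le> (u - v) * \<bar>r\<bar> powr p * (u - v) powr (p - 1)"
    by (intro mult_right_mono) (auto simp: algebra_simps)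
  also have "\<dots> = (u - v) powr p * \<bar>r\<bar> powr p"
    using powr_add[of "u - v" 1 "p - 1"] assms by simp
  also have "\<dots> = \<bar>(u - v) * r\<bar> powr p"
    using assms by (simp add: abs_mult powr_mult)
  finally show ?thesis by (simp add: rd)
qed

text \<open>
  Exchanging \<open>(u, t)\<close> with \<open>(v, s)\<close>, and changing the signs of \<open>u\<close> and \<open>v\<close>, reduces the claim to
  \<open>u > v \<ge> 0\<close>, except for \<open>u = v\<close>. Then \<open>z = 0\<close> if \<open>p > 1\<close>, whereas for \<open>p = 1\<close> the claim follows from
  \<open>\<bar>z\<bar> \<le> 1\<close> and the reverse triangle inequality.
\<close>

lemma picone_edge_inequality:
  fixes u v t s p :: real
  assumes p: "p \<ge> 1" and uv: "u * v \<ge> 0" and z: "z \<in> power_subgrad p (u - v)"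
  shows "(\<bar>t\<bar> powr p * u - \<bar>s\<bar> powr p * v) * z \<le> \<bar>t * u - s * v\<bar> powr p"
proof -
  have main: "(\<bar>t\<bar> powr p * u - \<bar>s\<bar> powr p * v) * z \<le> \<bar>t * u - s * v\<bar> powr p"
    if "u > v" "v \<ge> 0" "z \<in> power_subgrad p (u - v)" for u v t s z
    using picone_edge_inequality_aux[OF p that(2,1)] that by (simp add: power_subgrad_pos)
  have sym: "(\<bar>t\<bar> powr p * u - \<bar>s\<bar> powr p * v) * z \<le> \<bar>t * u - s * v\<bar> powr p"
    if "u \<noteq> v" "u \<ge> 0" "v \<ge> 0" "z \<in> power_subgrad p (u - v)" for u v t s z
  proof (cases "u > v")
    case True
    then show ?thesis using main that by blast
  next
    case False
    then show ?thesis
      using main[of u v "- z" s t] power_subgrad_uminus[OF that(4)] that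
      by (simp add: algebra_simps abs_minus_commute)
  qed
  show ?thesis
  proof (cases "u = v")
    case True
    show ?thesis
    proof (cases "p = 1")
      case False
      then show ?thesis using z True by (simp add: power_subgrad_def Phi_def)
    next
      case [simp]: True
      have "(\<bar>t\<bar> * u - \<bar>s\<bar> * u) * z \<le> \<bar>(\<bar>t\<bar> - \<bar>s\<bar>) * u\<bar> * \<bar>z\<bar>"
        by (metis abs_ge_self abs_mult left_diff_distrib)
      also have "\<dots> \<le> \<bar>(\<bar>t\<bar> - \<bar>s\<bar>) * u\<bar> * 1"
        using z \<open>u = v\<close> by (intro mult_left_mono) (auto simp: power_subgrad_def Sgn_def)
      also have "\<dots> \<le> \<bar>t - s\<bar> * \<bar>u\<bar>"
        by (simp add: abs_mult mult_right_mono abs_triangle_ineq3)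
      also have "\<dots> = \<bar>t * u - s * u\<bar>"
        by (simp add: left_diff_distrib flip: abs_mult)
      finally show ?thesis using \<open>u = v\<close> by simp
    qed
  next
    case False
    from uv consider "u \<ge> 0" "v \<ge> 0" | "u \<le> 0" "v \<le> 0"
      by (auto simp: zero_le_mult_iff)
    then show ?thesis
    proof cases
      case 1
      then show ?thesis using sym False z by blast
    next
      case 2
      then show ?thesis
        using sym[of "- u" "- v" "- z" t s] False power_subgrad_uminus[OF z]
        by (simp add: algebra_simps abs_minus_commute)
    qed
  qed
qed

section \<open>Energy of functions that rescale an eigenfunction domain by domain\<close>

text \<open>One form of the eigenvalue equation for all \<open>p \<ge> 1\<close>.\<close>

lemma eigenfunction_subgradE:
  assumes "signature_on E s" "eigenfunction p E w \<mu> \<kappa> s lam f"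
  obtains z a b where
    "\<forall>x y. {x, y} \<in> E \<longrightarrow>
      z x y \<in> power_subgrad p (f $ x - s {x, y} * f $ y) \<and> z x y = - s {x, y} * z y x"
    "\<forall>x. a x \<in> power_subgrad p (f $ x) \<and> b x \<in> power_subgrad p (f $ x)"
    "\<forall>x. (\<Sum>y | {x, y} \<in> E. w {x, y} * z x y) + \<kappa> x * a x = lam * \<mu> x * b x"
proof (cases "p = 1")
  case True
  then have sg: "power_subgrad p = Sgn" by (simp add: power_subgrad_def fun_eq_iff)
  from True obtain z a b where zab:
    "\<forall>x y. {x, y} \<in> E \<longrightarrow>
      z x y \<in> Sgn (f $ x - s {x, y} * f $ y) \<and> z x y = - s {x, y} * z y x"
    "\<forall>x. a x \<in> Sgn (f $ x) \<and> b x \<in> Sgn (f $ x)"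
    "\<forall>x. (\<Sum>y | {x, y} \<in> E. w {x, y} * z x y) + \<kappa> x * a x = lam * \<mu> x * b x"
    using assms(2) by (auto simp: eigenfunction_def eigenfunction_1_def)
  show ?thesis
    by (rule that[of z a b]) (use zab in \<open>unfold sg\<close>)
next
  case False
  define z where "z x y = Phi p (f $ x - s {x, y} * f $ y)" for x y
  have "z x y = - s {x, y} * z y x" if "{x, y} \<in> E" for x y
  proof -
    have "s {x, y} = 1 \<or> s {x, y} = -1" "{y, x} = {x, y}"
      using assms(1) that by (auto simp: signature_on_def)
    then show ?thesis
      by (auto simp: z_def Phi_def abs_minus_commute algebra_simps)
  qed
  then show ?thesis
    using False assms(2) that[of z "\<lambda>x. Phi p (f $ x)" "\<lambda>x. Phi p (f $ x)"]
    by (auto simp: eigenfunction_def p_laplacian_def power_subgrad_def z_def)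
qed

lemma sum_neighbours_le_sum_edges:
  fixes F :: "'v::finite \<Rightarrow> 'v \<Rightarrow> real"
  assumes "simple_graph E"
    and le: "\<And>x y. {x, y} \<in> E \<Longrightarrow> F x y + F y x \<le> h {x, y}"
  shows "(\<Sum>x\<in>UNIV. \<Sum>y | {x, y} \<in> E. F x y) \<le> (\<Sum>e\<in>E. h e)"
proof -
  define P where "P = {(x, y). {x, y} \<in> E}"
  have "(\<Sum>x\<in>UNIV. \<Sum>y | {x, y} \<in> E. F x y) = (\<Sum>(x, y)\<in>P. F x y)"
    by (subst sum.Sigma) (auto simp: P_def intro!: sum.cong)
  also have "\<dots> = (\<Sum>e\<in>E. \<Sum>(x, y)\<in>{q \<in> P. (\<lambda>(x, y). {x, y}) q = e}. F x y)"
    by (rule sum.group[symmetric]) (auto simp: P_def)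
  also have "\<dots> \<le> (\<Sum>e\<in>E. h e)"
  proof (rule sum_mono)
    fix e assume e: "e \<in> E"
    then obtain a b where ab: "e = {a, b}" "a \<noteq> b"
      using assms(1) by (auto simp: simple_graph_def card_2_iff)
    have "{b, a} \<in> E" using e ab by (simp add: insert_commute)
    then have "{q \<in> P. (\<lambda>(x, y). {x, y}) q = e} = {(a, b), (b, a)}"
      using e ab by (auto simp: P_def doubleton_eq_iff)
    then have "(\<Sum>(x, y)\<in>{q \<in> P. (\<lambda>(x, y). {x, y}) q = e}. F x y) = F a b + F b a"
      using ab(2) by simp
    also have "\<dots> \<le> h e"
      using le[of a b] e unfolding ab(1) .
    finally show "(\<Sum>(x, y)\<in>{q \<in> P. (\<lambda>(x, y). {x, y}) q = e}. F x y) \<le> h e" .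
  qed
  finally show ?thesis .
qed

text \<open>
  By the sign relation between \<open>z x y\<close> and \<open>z y x\<close>, the two contributions of an edge to the tested
  eigenvalue equation combine into the left-hand side of the Picone inequality.
\<close>

lemma energy_ge_of_const_on_domains:
  fixes f :: "real ^ 'v::finite"
  assumes G: "simple_graph E" and w: "\<And>e. e \<in> E \<Longrightarrow> w e > 0" and sig: "signature_on E s"
    and p: "p \<ge> 1" and eig: "eigenfunction p E w \<mu> \<kappa> s lam f"
    and t: "\<And>x y. {x, y} \<in> E \<Longrightarrow> f $ x * s {x, y} * f $ y < 0 \<Longrightarrow> t x = t y"
    and g: "\<And>x. g $ x = t x * f $ x"
  shows "lam * (\<Sum>x\<in>UNIV. \<mu> x * \<bar>g $ x\<bar> powr p)
    \<le> (\<Sum>e\<in>E. w e * edge_diff s g e powr p) + (\<Sum>x\<in>UNIV. \<kappa> x * \<bar>g $ x\<bar> powr p)"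
proof -
  obtain z a b where
    z: "\<forall>x y. {x, y} \<in> E \<longrightarrow>
      z x y \<in> power_subgrad p (f $ x - s {x, y} * f $ y) \<and> z x y = - s {x, y} * z y x"
    and ab: "\<forall>x. a x \<in> power_subgrad p (f $ x) \<and> b x \<in> power_subgrad p (f $ x)"
    and eq: "\<forall>x. (\<Sum>y | {x, y} \<in> E. w {x, y} * z x y) + \<kappa> x * a x = lam * \<mu> x * b x"
    by (rule eigenfunction_subgradE[OF sig eig])
  define T where "T x = \<bar>t x\<bar> powr p" for x
  have gT: "\<bar>g $ x\<bar> powr p = T x * \<bar>f $ x\<bar> powr p" for x
    by (simp add: g T_def abs_mult powr_mult)
  define F where "F x y = w {x, y} * (T x * f $ x * z x y)" for x y
  have tested: "lam * (\<mu> x * \<bar>g $ x\<bar> powr p)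
      = (\<Sum>y | {x, y} \<in> E. F x y) + \<kappa> x * \<bar>g $ x\<bar> powr p" for x
  proof -
    have aT: "T x * f $ x * a x = \<bar>g $ x\<bar> powr p" and bT: "T x * f $ x * b x = \<bar>g $ x\<bar> powr p"
      using ab power_subgrad_mult_self[of "a x" p "f $ x"] power_subgrad_mult_self[of "b x" p "f $ x"]
      by (simp_all add: gT mult.assoc mult.commute[of "f $ x"])
    have "T x * f $ x * (lam * \<mu> x * b x)
        = T x * f $ x * (\<Sum>y | {x, y} \<in> E. w {x, y} * z x y) + T x * f $ x * (\<kappa> x * a x)"
      by (simp only: eq[rule_format, symmetric] distrib_left)
    moreover have "T x * f $ x * (\<Sum>y | {x, y} \<in> E. w {x, y} * z x y) = (\<Sum>y | {x, y} \<in> E. F x y)"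
      by (simp add: F_def sum_distrib_left mult_ac)
    moreover have "T x * f $ x * (lam * \<mu> x * b x) = lam * (\<mu> x * \<bar>g $ x\<bar> powr p)"
      by (simp flip: bT)
    moreover have "T x * f $ x * (\<kappa> x * a x) = \<kappa> x * \<bar>g $ x\<bar> powr p"
      by (simp flip: aT)
    ultimately show ?thesis by simp
  qed
  have "(\<Sum>x\<in>UNIV. \<Sum>y | {x, y} \<in> E. F x y) \<le> (\<Sum>e\<in>E. w e * edge_diff s g e powr p)"
  proof (rule sum_neighbours_le_sum_edges[OF G])
    fix x y assume e: "{x, y} \<in> E"
    define c where "c = s {x, y}"
    have c: "c = 1 \<or> c = -1" and c': "s {y, x} = c"
      using sig e by (auto simp: signature_on_def c_def insert_commute)
    have zyx: "z y x = - c * z x y"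
    proof -
      have "{y, x} \<in> E" using e by (simp only: insert_commute)
      with z have "z y x = - s {y, x} * z x y" by blast
      then show ?thesis by (simp only: c')
    qed
    define u v where "u = f $ x" and "v = c * f $ y"
    have zuv: "z x y \<in> power_subgrad p (u - v)"
      using z[rule_format, OF e] unfolding u_def v_def c_def by (rule conjunct1)
    have diff: "edge_diff s g {x, y} = \<bar>t x * u - t y * v\<bar>"
      using c by (subst edge_diff_doubleton) (auto simp: c_def[symmetric] g u_def v_def mult_ac)
    have edge: "(T x * u - T y * v) * z x y \<le> \<bar>t x * u - t y * v\<bar> powr p"
    proof (cases "u * v < 0")
      case True
      \<comment> \<open>Both ends lie in one dual domain.\<close>
      then have "t x = t y"
        using t[OF e] by (simp add: u_def v_def c_def mult_ac)
      then have "(T x * u - T y * v) * z x y = T x * (z x y * (u - v))"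
        by (simp add: T_def algebra_simps)
      also have "\<dots> = \<bar>t x * (u - v)\<bar> powr p"
        using power_subgrad_mult_self[OF zuv] by (simp add: T_def abs_mult powr_mult)
      finally show ?thesis using \<open>t x = t y\<close> by (simp add: right_diff_distrib)
    next
      case False
      then show ?thesis
        using picone_edge_inequality[OF p _ zuv, of "t x" "t y"] by (simp add: T_def)
    qed
    have "F x y + F y x = w {x, y} * ((T x * u - T y * v) * z x y)"
      by (simp add: F_def zyx insert_commute u_def v_def algebra_simps)
    also have "\<dots> \<le> w {x, y} * edge_diff s g {x, y} powr p"
      using edge w[OF e] diff by (intro mult_left_mono) auto
    finally show "F x y + F y x \<le> w {x, y} * edge_diff s g {x, y} powr p" .
  qed
  then show ?thesis
    by (simp add: sum_distrib_left tested sum.distrib)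
qed

section \<open>The bound on dual nodal domains\<close>

text \<open>
  Choose a representative \<open>r x\<close> of the domain of each \<open>x\<close> with \<open>f x \<noteq> 0\<close>. The space \<open>W\<close> of the
  functions \<open>t f\<close> with \<open>t\<close> constant on the domains consists of the \<open>g\<close> with
  \<open>g x = (g (r x) / f (r x)) f x\<close> for every \<open>x\<close>; at a zero of \<open>f\<close> this says \<open>g x = 0\<close>, whatever \<open>r x\<close>
  is. At a representative the equation is trivial, which leaves one equation for each of the
  remaining \<open>n - m\<close> vertices, where \<open>m\<close> is the number of domains.
\<close>

lemma dual_strong_nodal_count_le:
  fixes f :: "real ^ 'v::finite"
  assumes G: "simple_graph E" and w: "\<And>e. e \<in> E \<Longrightarrow> w e > 0" and sig: "signature_on E s"
    and p: "p \<ge> 1" and eig: "eigenfunction p E w \<mu> \<kappa> s lam f"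
    and k: "k \<le> CARD('v)"
    and gt: "ereal lam > variational_eigenvalue p E w \<mu> \<kappa> s k"
  shows "dual_strong_nodal_count E s f \<le> CARD('v) - k"
proof (rule ccontr)
  assume many: "\<not> ?thesis"
  define R where "R = connection (strong_nodal_walk E (\<lambda>e. - s e) f) (nonzeros f)"
  have R: "equiv (nonzeros f) R"
    unfolding R_def by (rule equiv_strong_nodal)
  obtain r where r: "\<forall>x\<in>nonzeros f. r x \<in> nonzeros f" "\<forall>x y. (x, y) \<in> R \<longrightarrow> r x = r y"
      "\<forall>x\<in>nonzeros f. r (r x) = r x"
    and card_r: "card (r ` nonzeros f) = card (nonzeros f // R)"
    by (rule quotient_representatives[OF R])
  define N where "N = - (r ` nonzeros f)"
  have "card (r ` nonzeros f) = dual_strong_nodal_count E s f"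
    by (simp add: card_r dual_strong_nodal_count_def strong_nodal_count_def R_def)
  moreover have "card N = CARD('v) - card (r ` nonzeros f)"
    by (simp add: N_def Compl_eq_Diff_UNIV card_Diff_subset)
  moreover have "card (r ` nonzeros f) \<le> CARD('v)"
    by (rule card_mono) auto
  ultimately have "card N < k"
    using many k by linarith
  have "ereal lam \<le> (SUP g \<in> S. ereal (rayleigh p E w \<mu> \<kappa> s g))"
    if S: "S \<in> genus_family k (p_sphere p \<mu>)" for S
  proof -
    define L where "L x g = g $ x - g $ r x / f $ r x * f $ x" for x and g :: "real ^ 'v"
    have "\<exists>g\<in>S. \<forall>x\<in>N. L x g = 0"
      using S \<open>card N < k\<close>
      by (intro genus_family_common_zero) (auto simp: L_def divide_inverse intro!: continuous_intros)
    then obtain g where g: "g \<in> S" "\<And>x. x \<in> N \<Longrightarrow> L x g = 0" by blast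
    define t where "t x = g $ r x / f $ r x" for x
    have g_eq: "g $ x = t x * f $ x" for x
    proof (cases "x \<in> N")
      case True
      then show ?thesis using g(2)[of x] by (simp add: L_def t_def)
    next
      case False
      then have "r x = x" "f $ x \<noteq> 0"
        using r by (auto simp: N_def nonzeros_def)
      then show ?thesis by (simp add: t_def)
    qed
    have t: "t x = t y" if "{x, y} \<in> E" "f $ x * s {x, y} * f $ y < 0" for x y
    proof -
      have "(x, y) \<in> R"
        unfolding R_def using that by (intro same_strong_domain_of_edge) auto
      then show ?thesis using r(2) by (simp add: t_def)
    qed
    have "(\<Sum>x\<in>UNIV. \<mu> x * \<bar>g $ x\<bar> powr p) = 1"
      using S g(1) by (auto simp: genus_family_def p_sphere_def)
    then have "lam \<le> rayleigh p E w \<mu> \<kappa> s g"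
      using energy_ge_of_const_on_domains[OF G w sig p eig t g_eq] by (simp add: rayleigh_def)
    then show ?thesis
      using g(1) by (intro SUP_upper2[of g]) auto
  qed
  then have "ereal lam \<le> variational_eigenvalue p E w \<mu> \<kappa> s k"
    unfolding variational_eigenvalue_def by (intro INF_greatest)
  with gt show False by simp
qed

theorem theorem2:
  fixes E :: "'v::finite set set"
    and w :: "'v set \<Rightarrow> real"
    and \<mu> \<kappa> :: "'v \<Rightarrow> real"
    and \<sigma> :: "'v set \<Rightarrow> real"
    and f :: "real ^ 'v"
    and p lam :: real
    and k :: nat
  assumes "simple_graph E"
    and "\<And>e. e \<in> E \<Longrightarrow> w e > 0"
    and "\<And>x. \<mu> x > 0"
    and "signature_on E \<sigma>"
    and "p \<ge> 1"
    and "eigenfunction p E w \<mu> \<kappa> \<sigma> lam f"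
    and "1 \<le> k" and "k \<le> CARD('v)"
    and "ereal lam > variational_eigenvalue p E w \<mu> \<kappa> \<sigma> k"
  shows "dual_weak_nodal_count E \<sigma> f \<le> dual_strong_nodal_count E \<sigma> f \<and>
    dual_strong_nodal_count E \<sigma> f \<le> CARD('v) - k"
  using assms weak_nodal_count_le_strong_nodal_count[of E "\<lambda>e. - \<sigma> e" f]
    dual_strong_nodal_count_le[of E w \<sigma> p \<mu> \<kappa> lam f k]
  by (simp add: dual_weak_nodal_count_def dual_strong_nodal_count_def)

end
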